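(* Let $k=\mathbb{Q}(\theta_1,\theta_2)$ be the purely transcendental extension of $\mathbb{Q}$ of degree $2$ (with $\theta_1,\theta_2$ algebraically independent), and let $\varphi$ be the automorphism of $k$ with $\varphi(\theta_1)=\theta_2$, $\varphi(\theta_2)=\theta_1$. Let $\Theta$ be the variety of all representations of groups over $k$-linear spaces, let $F=F(x^{(1)},x^{(2)})$ be the free representation with one free generator $x^{(1)}$ of the group sort and one free generator $x^{(2)}$ of the vector sort, let $T$ be the congruence of $F$ generated by the pair $(x^{(1)}\circ x^{(2)},\theta_1x^{(2)})$, and let $H=F/T$. Let $H_W^*$ be the representation with the same underlying sets as $H$ and the same operations, except that for every $\lambda\in k$ the operation of multiplication of vectors by the scalar $\lambda$ in $H_W^*$ is $v\mapsto\varphi(\lambda)v$ (computed in $H$). Then the representations $H$ and $H_W^*$ are not geometrically equivalent.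
   Context: A representation of a group over a $k$-linear space is a two-sorted algebra $H$ with sorts $\{1,2\}$: $H^{(1)}$ is a group, $H^{(2)}$ is a $k$-linear space, and there is an operation $\circ$ of type $(1,2;2)$ such that $v\mapsto g\circ v$ is $k$-linear for each $g\in H^{(1)}$, $1\circ v=v$ and $(g_1g_2)\circ v=g_1\circ(g_2\circ v)$. The signature consists of the unit, inverse and multiplication in the group; zero, negation, addition and, for each $\lambda\in k$, multiplication by the scalar $\lambda$ in the linear space; and $\circ$. A homomorphism is a pair consisting of a group homomorphism and a $k$-linear map compatible with the actions. Congruences are compatible equivalences contained in $(H^{(1)})^2\cup(H^{(2)})^2$. Let $X_0$ be a two-sorted set with countably infinitely many elements of each sort. The objects of $\Theta^0$ are the free algebras $F(X)$ of $\Theta$ with $X\subset X_0$ finite: if $X^{(i)}$ is the set of elements of $X$ of sort $i$, then $F(X)^{(1)}$ is the free group $G(X^{(1)})$ and $F(X)^{(2)}$ is the free $kG(X^{(1)})$-module with basis $X^{(2)}$. For $F\in\mathrm{Ob}\,\Theta^0$, $H\in\Theta$ and $T\subseteq(F^{(1)})^2\cup(F^{(2)})^2$ put $T_H''=\bigcap\{\ker\psi\mid\psi\in\mathrm{Hom}(F,H),\ T\subseteq\ker\psi\}$, where $\ker\psi=\{(a,b)\mid\psi(a)=\psi(b)\}$, regarded as a subset of $(F^{(1)})^2\cup(F^{(2)})^2$. Algebras $H_1,H_2\in\Theta$ are geometrically equivalent if $T_{H_1}''=T_{H_2}''$ for every $F\in\mathrm{Ob}\,\Theta^0$ and every $T\subseteq(F^{(1)})^2\cup(F^{(2)})^2$.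 *)

theory Defs
  imports "HOL-Algebra.Algebraic_Closure_Type"
begin

section \<open>Representations of groups over vector spaces\<close>

text \<open>
  The group sort is a group of HOL-Algebra, the vector sort is a module over the field \<open>k\<close>, and
  \<open>k\<close> is the type \<open>'k\<close>, turned into a ring record by \<open>ring_of_type_algebra\<close>.
  A module record also has the ring fields \<open>mult\<close> and \<open>one\<close>; they play no role
  for modules, and nothing below depends on them.
\<close>

record ('k, 'g, 'v) rep =
  grp :: "'g monoid"
  vecs :: "('k, 'v) module"
  act :: "'g \<Rightarrow> 'v \<Rightarrow> 'v"

definition linear_maps :: "('k, 'v) module \<Rightarrow> ('k, 'w) module \<Rightarrow> ('v \<Rightarrow> 'w) set" where
  "linear_maps V W = {f \<in> hom (add_monoid V) (add_monoid W).
     \<forall>c. \<forall>v\<in>carrier V. f (c \<odot>\<^bsub>V\<^esub> v) = c \<odot>\<^bsub>W\<^esub> f v}"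

text \<open>Membership in the variety \<open>\<Theta>\<close>.\<close>

definition representation :: "('k::field, 'g, 'v) rep \<Rightarrow> bool" where
  "representation H \<longleftrightarrow>
     group (grp H) \<and> module ring_of_type_algebra (vecs H) \<and>
     (\<forall>g\<in>carrier (grp H). act H g \<in> linear_maps (vecs H) (vecs H)) \<and>
     (\<forall>v\<in>carrier (vecs H). act H \<one>\<^bsub>grp H\<^esub> v = v) \<and>
     (\<forall>g\<in>carrier (grp H). \<forall>h\<in>carrier (grp H). \<forall>v\<in>carrier (vecs H).
        act H (g \<otimes>\<^bsub>grp H\<^esub> h) v = act H g (act H h v))"

definition rep_hom ::
    "('k, 'g, 'v) rep \<Rightarrow> ('k, 'h, 'w) rep \<Rightarrow> (('g \<Rightarrow> 'h) \<times> ('v \<Rightarrow> 'w)) set" where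
  "rep_hom F H = {(\<alpha>, \<beta>). \<alpha> \<in> hom (grp F) (grp H) \<and> \<beta> \<in> linear_maps (vecs F) (vecs H) \<and>
     (\<forall>g\<in>carrier (grp F). \<forall>v\<in>carrier (vecs F). \<beta> (act F g v) = act H (\<alpha> g) (\<beta> v))}"

section \<open>Congruences and quotients\<close>

text \<open>
  The disjoint union of the squares of the two sorts: \<open>Inl (g, h)\<close> is a pair of
  the group sort and \<open>Inr (v, w)\<close> a pair of the vector sort.
\<close>

definition sort_pairs :: "('k, 'g, 'v) rep \<Rightarrow> ('g \<times> 'g + 'v \<times> 'v) set" where
  "sort_pairs F =
     (carrier (grp F) \<times> carrier (grp F)) <+> (carrier (vecs F) \<times> carrier (vecs F))"

definition rep_kernel ::
    "('k, 'g, 'v) rep \<Rightarrow> ('g \<Rightarrow> 'h) \<times> ('v \<Rightarrow> 'w) \<Rightarrow> ('g \<times> 'g + 'v \<times> 'v) set" where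
  "rep_kernel F \<psi> =
     {(g, h). g \<in> carrier (grp F) \<and> h \<in> carrier (grp F) \<and> fst \<psi> g = fst \<psi> h} <+>
     {(v, w). v \<in> carrier (vecs F) \<and> w \<in> carrier (vecs F) \<and> snd \<psi> v = snd \<psi> w}"

definition congruence :: "('k, 'g, 'v) rep \<Rightarrow> ('g \<times> 'g + 'v \<times> 'v) set \<Rightarrow> bool" where
  "congruence F R \<longleftrightarrow>
     equiv (carrier (grp F)) (Inl -` R) \<and> equiv (carrier (vecs F)) (Inr -` R) \<and>
     (\<forall>g g' h h'. Inl (g, g') \<in> R \<longrightarrow> Inl (h, h') \<in> R \<longrightarrow>
        Inl (g \<otimes>\<^bsub>grp F\<^esub> h, g' \<otimes>\<^bsub>grp F\<^esub> h') \<in> R) \<and>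
     (\<forall>g g'. Inl (g, g') \<in> R \<longrightarrow> Inl (inv\<^bsub>grp F\<^esub> g, inv\<^bsub>grp F\<^esub> g') \<in> R) \<and>
     (\<forall>v v' w w'. Inr (v, v') \<in> R \<longrightarrow> Inr (w, w') \<in> R \<longrightarrow>
        Inr (v \<oplus>\<^bsub>vecs F\<^esub> w, v' \<oplus>\<^bsub>vecs F\<^esub> w') \<in> R) \<and>
     (\<forall>v v'. Inr (v, v') \<in> R \<longrightarrow> Inr (\<ominus>\<^bsub>vecs F\<^esub> v, \<ominus>\<^bsub>vecs F\<^esub> v') \<in> R) \<and>
     (\<forall>c v v'. Inr (v, v') \<in> R \<longrightarrow> Inr (c \<odot>\<^bsub>vecs F\<^esub> v, c \<odot>\<^bsub>vecs F\<^esub> v') \<in> R) \<and>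
     (\<forall>g g' v v'. Inl (g, g') \<in> R \<longrightarrow> Inr (v, v') \<in> R \<longrightarrow>
        Inr (act F g v, act F g' v') \<in> R)"

definition generated_congruence ::
    "('k, 'g, 'v) rep \<Rightarrow> ('g \<times> 'g + 'v \<times> 'v) set \<Rightarrow> ('g \<times> 'g + 'v \<times> 'v) set" where
  "generated_congruence F S = \<Inter>{R. congruence F R \<and> S \<subseteq> R}"

text \<open>For a congruence, each union below collapses to the class of the result on any
  representatives.\<close>

definition quotient_rep ::
    "('k, 'g, 'v) rep \<Rightarrow> ('g \<times> 'g + 'v \<times> 'v) set \<Rightarrow> ('k, 'g set, 'v set) rep" where
  "quotient_rep F R =
     \<lparr>grp = \<lparr>carrier = carrier (grp F) // (Inl -` R),
             monoid.mult = (\<lambda>A B. \<Union>a\<in>A. \<Union>b\<in>B. (Inl -` R) `` {a \<otimes>\<^bsub>grp F\<^esub> b}),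
             monoid.one = (Inl -` R) `` {\<one>\<^bsub>grp F\<^esub>}\<rparr>,
      vecs = \<lparr>carrier = carrier (vecs F) // (Inr -` R),
              monoid.mult = undefined, monoid.one = undefined,
              ring.zero = (Inr -` R) `` {\<zero>\<^bsub>vecs F\<^esub>},
              ring.add = (\<lambda>A B. \<Union>a\<in>A. \<Union>b\<in>B. (Inr -` R) `` {a \<oplus>\<^bsub>vecs F\<^esub> b}),
              module.smult = (\<lambda>c A. \<Union>a\<in>A. (Inr -` R) `` {c \<odot>\<^bsub>vecs F\<^esub> a})\<rparr>,
      act = (\<lambda>A B. \<Union>a\<in>A. \<Union>b\<in>B. (Inr -` R) `` {act F a b})\<rparr>"

section \<open>Free representations\<close>

text \<open>The letter \<open>(x, True)\<close> stands for \<open>x\<close> and \<open>(x, False)\<close> for its inverse.\<close>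

inductive_set word_eq :: "'x set \<Rightarrow> (('x \<times> bool) list \<times> ('x \<times> bool) list) set"
  for A :: "'x set" where
  refl: "u \<in> lists (A \<times> UNIV) \<Longrightarrow> (u, u) \<in> word_eq A"
| sym: "(u, v) \<in> word_eq A \<Longrightarrow> (v, u) \<in> word_eq A"
| trans: "(u, v) \<in> word_eq A \<Longrightarrow> (v, w) \<in> word_eq A \<Longrightarrow> (u, w) \<in> word_eq A"
| cancel: "u \<in> lists (A \<times> UNIV) \<Longrightarrow> v \<in> lists (A \<times> UNIV) \<Longrightarrow> x \<in> A \<Longrightarrow>
    (u @ (x, b) # (x, \<not> b) # v, u @ v) \<in> word_eq A"

definition free_group :: "'x set \<Rightarrow> ('x \<times> bool) list set monoid" where
  "free_group A =
     \<lparr>carrier = lists (A \<times> UNIV) // word_eq A,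
      monoid.mult = (\<lambda>U V. \<Union>u\<in>U. \<Union>v\<in>V. word_eq A `` {u @ v}),
      monoid.one = word_eq A `` {[]}\<rparr>"

text \<open>
  With \<open>G = free_group A\<close>, an element of the free \<open>kG\<close>-module with basis \<open>B\<close> is a finite
  \<open>k\<close>-linear combination of the elements \<open>h \<circ> y\<close> with \<open>h \<in> G\<close> and \<open>y \<in> B\<close>; it is
  represented by the function giving the coefficient at each \<open>(h, y)\<close>. The action sends
  \<open>h \<circ> y\<close> to \<open>(g h) \<circ> y\<close>, so the coefficient of \<open>g \<circ> f\<close> at \<open>(h, y)\<close> is that of \<open>f\<close> at
  \<open>(g\<^sup>-\<^sup>1 h, y)\<close>.
\<close>

definition free_rep ::
    "'x set \<Rightarrow> 'y set \<Rightarrow>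
     ('k::field, ('x \<times> bool) list set, ('x \<times> bool) list set \<times> 'y \<Rightarrow> 'k) rep" where
  "free_rep A B =
     \<lparr>grp = free_group A,
      vecs = \<lparr>carrier = {f. finite {p. f p \<noteq> 0} \<and> {p. f p \<noteq> 0} \<subseteq> carrier (free_group A) \<times> B},
              monoid.mult = undefined, monoid.one = undefined,
              ring.zero = (\<lambda>p. 0),
              ring.add = (\<lambda>f f' p. f p + f' p),
              module.smult = (\<lambda>c f p. c * f p)\<rparr>,
      act = (\<lambda>g f (h, y). if h \<in> carrier (free_group A)
               then f (inv\<^bsub>free_group A\<^esub> g \<otimes>\<^bsub>free_group A\<^esub> h, y) else 0)\<rparr>"

definition group_gen :: "'x set \<Rightarrow> 'x \<Rightarrow> ('x \<times> bool) list set" where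
  "group_gen A x = word_eq A `` {[(x, True)]}"

definition vec_gen :: "'x set \<Rightarrow> 'y \<Rightarrow> ('x \<times> bool) list set \<times> 'y \<Rightarrow> 'k::field" where
  "vec_gen A y = (\<lambda>p. if p = (\<one>\<^bsub>free_group A\<^esub>, y) then 1 else 0)"

section \<open>Geometric equivalence\<close>

definition closure_in ::
    "('k, 'g, 'v) rep \<Rightarrow> ('k, 'h, 'w) rep \<Rightarrow> ('g \<times> 'g + 'v \<times> 'v) set
       \<Rightarrow> ('g \<times> 'g + 'v \<times> 'v) set" where
  "closure_in F H T = \<Inter>{rep_kernel F \<psi> | \<psi>. \<psi> \<in> rep_hom F H \<and> T \<subseteq> rep_kernel F \<psi>}"

text \<open>The set \<open>X\<^sub>0\<close> consists of a copy of \<open>nat\<close> in each of the two sorts. No intersection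
  is over an empty family, because of the trivial homomorphism.\<close>

definition geometrically_equivalent ::
    "('k::field, 'g, 'v) rep \<Rightarrow> ('k, 'h, 'w) rep \<Rightarrow> bool" where
  "geometrically_equivalent H\<^sub>1 H\<^sub>2 \<longleftrightarrow>
     (\<forall>(A :: nat set) (B :: nat set) T. finite A \<longrightarrow> finite B \<longrightarrow> T \<subseteq> sort_pairs (free_rep A B) \<longrightarrow>
        closure_in (free_rep A B) H\<^sub>1 T = closure_in (free_rep A B) H\<^sub>2 T)"

section \<open>The field and the twisted representation\<close>

text \<open>The outer variable of \<open>p\<close> is replaced by \<open>b\<close> and the inner one by \<open>a\<close>.\<close>

definition eval2 :: "rat poly poly \<Rightarrow> 'k::field_char_0 \<Rightarrow> 'k \<Rightarrow> 'k" where
  "eval2 p a b = poly (map_poly (\<lambda>q. poly (map_poly of_rat q) a) p) b"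

text \<open>The type \<open>'k\<close> is the field \<open>\<rat>(a, b)\<close> with \<open>a\<close>, \<open>b\<close> algebraically independent
  over \<open>\<rat>\<close>.\<close>

definition rational_function_field :: "'k::field_char_0 \<Rightarrow> 'k \<Rightarrow> bool" where
  "rational_function_field a b \<longleftrightarrow>
     (\<forall>p. eval2 p a b = 0 \<longrightarrow> p = 0) \<and>
     (\<forall>z. \<exists>p q. eval2 q a b \<noteq> 0 \<and> z = eval2 p a b / eval2 q a b)"

definition twist :: "('k \<Rightarrow> 'k) \<Rightarrow> ('k, 'g, 'v) rep \<Rightarrow> ('k, 'g, 'v) rep" where
  "twist \<phi> H = H\<lparr>vecs := (vecs H)\<lparr>module.smult := (\<lambda>c v. \<phi> c \<odot>\<^bsub>vecs H\<^esub> v)\<rparr>\<rparr>"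


section \<open>The constructions stay inside the variety\<close>

lemma word_eq_lists: "(u, v) \<in> word_eq A \<Longrightarrow> u \<in> lists (A \<times> UNIV) \<and> v \<in> lists (A \<times> UNIV)"
  by (induction rule: word_eq.induct) auto

lemma equiv_word_eq: "equiv (lists (A \<times> UNIV)) (word_eq A)"
proof (rule equivI)
  show "word_eq A \<subseteq> lists (A \<times> UNIV) \<times> lists (A \<times> UNIV)"
    using word_eq_lists by fast
  show "refl_on (lists (A \<times> UNIV)) (word_eq A)"
    by (rule refl_onI) (rule word_eq.refl)
  show "Relation.sym (word_eq A)"
    by (rule symI) (rule word_eq.sym)
  show "Relation.trans (word_eq A)"
    by (rule transI) (rule word_eq.trans)
qed

lemma word_eq_append_left:
  "(u, v) \<in> word_eq A \<Longrightarrow> w \<in> lists (A \<times> UNIV) \<Longrightarrow> (w @ u, w @ v) \<in> word_eq A"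
proof (induction rule: word_eq.induct)
  case (refl u)
  then show ?case by (intro word_eq.refl) auto
next
  case (cancel u v x b)
  then show ?case using word_eq.cancel[of "w @ u" A v x b] by auto
qed (blast intro: word_eq.sym word_eq.trans)+

lemma word_eq_append_right:
  "(u, v) \<in> word_eq A \<Longrightarrow> w \<in> lists (A \<times> UNIV) \<Longrightarrow> (u @ w, v @ w) \<in> word_eq A"
proof (induction rule: word_eq.induct)
  case (refl u)
  then show ?case by (intro word_eq.refl) auto
next
  case (cancel u v x b)
  then show ?case using word_eq.cancel[of u A "v @ w" x b] by auto
qed (blast intro: word_eq.sym word_eq.trans)+

lemma word_eq_append:
  "(u, u') \<in> word_eq A \<Longrightarrow> (v, v') \<in> word_eq A \<Longrightarrow> (u @ v, u' @ v') \<in> word_eq A"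
  using word_eq_append_left[of v v' A u] word_eq_append_right[of u u' A v'] word_eq_lists
  by (metis word_eq.trans)

lemma free_group_mult:
  assumes "u \<in> lists (A \<times> UNIV)" "v \<in> lists (A \<times> UNIV)"
  shows "(word_eq A `` {u}) \<otimes>\<^bsub>free_group A\<^esub> (word_eq A `` {v}) = word_eq A `` {u @ v}"
proof -
  have "(\<lambda>u v. word_eq A `` {u @ v}) respects2 (word_eq A)"
    by (rule congruent2I') (auto intro!: equiv_class_eq[OF equiv_word_eq] word_eq_append)
  from UN_equiv_class2[OF equiv_word_eq equiv_word_eq this assms] show ?thesis
    by (simp add: free_group_def)
qed

lemma free_group_cases:
  assumes "g \<in> carrier (free_group A)"
  obtains u where "u \<in> lists (A \<times> UNIV)" "g = word_eq A `` {u}"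
  using assms by (auto simp: free_group_def elim!: quotientE)

lemma free_group_class: "u \<in> lists (A \<times> UNIV) \<Longrightarrow> word_eq A `` {u} \<in> carrier (free_group A)"
  by (auto simp: free_group_def intro: quotientI)

lemma free_group_one: "\<one>\<^bsub>free_group A\<^esub> = word_eq A `` {[]}"
  by (simp add: free_group_def)

lemma word_inverse:
  assumes "u \<in> lists (A \<times> UNIV)"
  shows "\<exists>v\<in>lists (A \<times> UNIV). (v @ u, []) \<in> word_eq A"
  using assms
proof (induction u)
  case Nil
  then show ?case by (auto intro!: bexI[of _ "[]"] word_eq.refl)
next
  case (Cons p u)
  obtain x b where p: "p = (x, b)" by (cases p)
  from Cons obtain v where v: "v \<in> lists (A \<times> UNIV)" "(v @ u, []) \<in> word_eq A" by auto
  have "(v @ (x, \<not> b) # (x, \<not> \<not> b) # u, v @ u) \<in> word_eq A"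
    using Cons p v by (intro word_eq.cancel) auto
  then have "((v @ [(x, \<not> b)]) @ p # u, []) \<in> word_eq A"
    using v p by (auto intro: word_eq.trans)
  then show ?case
    using v Cons p by (intro bexI[of _ "v @ [(x, \<not> b)]"]) auto
qed

lemma group_free_group: "group (free_group A)"
proof (rule groupI)
  show "\<one>\<^bsub>free_group A\<^esub> \<in> carrier (free_group A)"
    by (auto simp: free_group_one intro: free_group_class)
next
  fix g h assume "g \<in> carrier (free_group A)" "h \<in> carrier (free_group A)"
  then show "g \<otimes>\<^bsub>free_group A\<^esub> h \<in> carrier (free_group A)"
    by (elim free_group_cases) (simp add: free_group_mult free_group_class del: in_lists_conv_set)
next
  fix g h l
  assume "g \<in> carrier (free_group A)" "h \<in> carrier (free_group A)" "l \<in> carrier (free_group A)"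
  then show "g \<otimes>\<^bsub>free_group A\<^esub> h \<otimes>\<^bsub>free_group A\<^esub> l =
      g \<otimes>\<^bsub>free_group A\<^esub> (h \<otimes>\<^bsub>free_group A\<^esub> l)"
    by (elim free_group_cases) (simp add: free_group_mult del: in_lists_conv_set)
next
  fix g assume "g \<in> carrier (free_group A)"
  then show "\<one>\<^bsub>free_group A\<^esub> \<otimes>\<^bsub>free_group A\<^esub> g = g"
    by (elim free_group_cases) (simp add: free_group_one free_group_mult del: in_lists_conv_set)
next
  fix g assume "g \<in> carrier (free_group A)"
  then obtain u where u: "u \<in> lists (A \<times> UNIV)" "g = word_eq A `` {u}" by (elim free_group_cases)
  from word_inverse[OF u(1)] obtain v
    where v: "v \<in> lists (A \<times> UNIV)" "(v @ u, []) \<in> word_eq A" by blast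
  have "(word_eq A `` {v}) \<otimes>\<^bsub>free_group A\<^esub> g = \<one>\<^bsub>free_group A\<^esub>"
    unfolding u free_group_mult[OF v(1) u(1)] free_group_one
    by (rule equiv_class_eq[OF equiv_word_eq v(2)])
  then show "\<exists>h\<in>carrier (free_group A). h \<otimes>\<^bsub>free_group A\<^esub> g = \<one>\<^bsub>free_group A\<^esub>"
    using free_group_class[OF v(1)] by blast
qed

lemma ring_of_type_algebra_simps [simp]:
  "carrier ring_of_type_algebra = UNIV"
  "x \<otimes>\<^bsub>ring_of_type_algebra\<^esub> y = x * y"
  "x \<oplus>\<^bsub>ring_of_type_algebra\<^esub> y = x + y"
  "\<one>\<^bsub>ring_of_type_algebra\<^esub> = 1"
  by (simp_all add: ring_of_type_algebra_def)

lemma group_homI: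
  assumes "\<And>x. x \<in> carrier G \<Longrightarrow> f x \<in> carrier H"
    and "\<And>x y. x \<in> carrier G \<Longrightarrow> y \<in> carrier G \<Longrightarrow> f (x \<otimes>\<^bsub>G\<^esub> y) = f x \<otimes>\<^bsub>H\<^esub> f y"
  shows "f \<in> hom G H"
  using assms by (auto simp: hom_def)

lemma act_free_rep_carrier:
  assumes g: "g \<in> carrier (grp (free_rep A B))"
    and f: "f \<in> carrier (vecs (free_rep A B :: ('k::field, _, _) rep))"
  shows "act (free_rep A B) g f \<in> carrier (vecs (free_rep A B :: ('k, _, _) rep))"
proof -
  let ?G = "free_group A"
  interpret G: group ?G by (rule group_free_group)
  have g: "g \<in> carrier ?G" using g by (simp add: free_rep_def)
  have f: "finite {p. f p \<noteq> 0}" "{p. f p \<noteq> 0} \<subseteq> carrier ?G \<times> B"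
    using f by (auto simp: free_rep_def)
  have sub: "{p. act (free_rep A B) g f p \<noteq> 0} \<subseteq> (\<lambda>(h, y). (g \<otimes>\<^bsub>?G\<^esub> h, y)) ` {p. f p \<noteq> 0}"
  proof clarify
    fix h y assume "act (free_rep A B) g f (h, y) \<noteq> 0"
    then have h: "h \<in> carrier ?G" "f (inv\<^bsub>?G\<^esub> g \<otimes>\<^bsub>?G\<^esub> h, y) \<noteq> 0"
      by (auto simp: free_rep_def split: if_splits)
    moreover have "h = g \<otimes>\<^bsub>?G\<^esub> (inv\<^bsub>?G\<^esub> g \<otimes>\<^bsub>?G\<^esub> h)"
      using g h by (simp add: G.m_assoc[symmetric])
    ultimately show "(h, y) \<in> (\<lambda>(h, y). (g \<otimes>\<^bsub>?G\<^esub> h, y)) ` {p. f p \<noteq> 0}"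
      by (intro image_eqI[of _ _ "(inv\<^bsub>?G\<^esub> g \<otimes>\<^bsub>?G\<^esub> h, y)"]) auto
  qed
  moreover have "(\<lambda>(h, y). (g \<otimes>\<^bsub>?G\<^esub> h, y)) ` {p. f p \<noteq> 0} \<subseteq> carrier ?G \<times> B"
    using f(2) g by auto
  ultimately show ?thesis
    using finite_subset[OF sub finite_imageI[OF f(1)]] by (simp add: free_rep_def)
qed

lemma module_free_rep:
  "module ring_of_type_algebra (vecs (free_rep A B :: ('k::field, _, _) rep))"
proof (rule moduleI)
  let ?V = "vecs (free_rep A B :: ('k, _, _) rep)"
  show "abelian_group ?V"
  proof (rule abelian_groupI)
    fix f f' assume "f \<in> carrier ?V" "f' \<in> carrier ?V"
    then have *: "finite ({p. f p \<noteq> 0} \<union> {p. f' p \<noteq> 0})"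
      "{p. f p \<noteq> 0} \<union> {p. f' p \<noteq> 0} \<subseteq> carrier (free_group A) \<times> B"
      by (auto simp: free_rep_def)
    have "{p. f p + f' p \<noteq> 0} \<subseteq> {p. f p \<noteq> 0} \<union> {p. f' p \<noteq> 0}" by auto
    with * show "f \<oplus>\<^bsub>?V\<^esub> f' \<in> carrier ?V"
      by (auto simp: free_rep_def intro: finite_subset)
  next
    fix f assume f: "f \<in> carrier ?V"
    then have "(\<lambda>p. - f p) \<in> carrier ?V" by (simp add: free_rep_def)
    then show "\<exists>f'\<in>carrier ?V. f' \<oplus>\<^bsub>?V\<^esub> f = \<zero>\<^bsub>?V\<^esub>"
      by (rule bexI[rotated]) (simp add: free_rep_def)
  qed (auto simp: free_rep_def algebra_simps)
  fix c :: 'k and f assume "f \<in> carrier ?V"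
  then have *: "finite {p. f p \<noteq> 0}" "{p. f p \<noteq> 0} \<subseteq> carrier (free_group A) \<times> B"
    by (auto simp: free_rep_def)
  have "{p. c * f p \<noteq> 0} \<subseteq> {p. f p \<noteq> 0}" by auto
  with * show "c \<odot>\<^bsub>?V\<^esub> f \<in> carrier ?V"
    by (auto simp: free_rep_def intro: finite_subset)
qed (auto simp: free_rep_def algebra_simps)

lemma representation_free_rep: "representation (free_rep A B :: ('k::field, _, _) rep)"
proof -
  let ?F = "free_rep A B :: ('k, _, _) rep"
  interpret G: group "free_group A" by (rule group_free_group)
  have *: "act ?F g \<in> linear_maps (vecs ?F) (vecs ?F)" if "g \<in> carrier (grp ?F)" for g
    unfolding linear_maps_def
  proof (intro CollectI conjI group_homI allI ballI)
    show "act ?F g f \<in> carrier (add_monoid (vecs ?F))" if "f \<in> carrier (add_monoid (vecs ?F))" for f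
      using act_free_rep_carrier[OF \<open>g \<in> _\<close>] that by simp
  qed (auto simp: free_rep_def fun_eq_iff)
  have **: "act ?F \<one>\<^bsub>grp ?F\<^esub> f = f" if "f \<in> carrier (vecs ?F)" for f
    using that by (auto simp: free_rep_def fun_eq_iff)
  have "act ?F (g \<otimes>\<^bsub>grp ?F\<^esub> h) f = act ?F g (act ?F h f)"
    if "g \<in> carrier (grp ?F)" "h \<in> carrier (grp ?F)" for g h f
    using that by (auto simp: free_rep_def fun_eq_iff G.inv_mult_group G.m_assoc)
  with * ** module_free_rep show ?thesis
    by (auto simp: representation_def) (auto simp: free_rep_def G.group_axioms)
qed

lemma gens_in_free_rep:
  "x \<in> A \<Longrightarrow> group_gen A x \<in> carrier (grp (free_rep A B))"
  "y \<in> B \<Longrightarrow> vec_gen A y \<in> carrier (vecs (free_rep A B :: ('k::field, _, _) rep))"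
  using group.is_monoid[OF group_free_group, of A]
  by (auto simp: free_rep_def group_gen_def vec_gen_def free_group_class monoid.one_closed)

lemma equiv_Times: "equiv S (S \<times> S)"
  by (auto simp: equiv_def refl_on_def Relation.sym_def Relation.trans_def)

lemma congruence_sort_pairs:
  assumes "representation F"
  shows "congruence F (sort_pairs F)"
proof -
  interpret G: group "grp F" using assms by (simp add: representation_def)
  interpret V: module ring_of_type_algebra "vecs F" using assms by (simp add: representation_def)
  have "Inl -` sort_pairs F = carrier (grp F) \<times> carrier (grp F)"
    and "Inr -` sort_pairs F = carrier (vecs F) \<times> carrier (vecs F)"
    by (auto simp: sort_pairs_def)
  moreover note equiv_Times[of "carrier (grp F)"] equiv_Times[of "carrier (vecs F)"]
  moreover have "act F g v \<in> carrier (vecs F)"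
    if "g \<in> carrier (grp F)" "v \<in> carrier (vecs F)" for g v
    using that assms by (auto simp: representation_def linear_maps_def hom_def)
  moreover have "c \<odot>\<^bsub>vecs F\<^esub> v \<in> carrier (vecs F)" if "v \<in> carrier (vecs F)" for c v
    using that V.smult_closed[of c v] by simp
  ultimately show ?thesis
    unfolding congruence_def by (auto simp: sort_pairs_def)
qed

lemma equiv_INT:
  assumes "I \<noteq> {}" "\<And>i. i \<in> I \<Longrightarrow> equiv S (r i)"
  shows "equiv S (\<Inter>i\<in>I. r i)"
proof (rule equivI)
  show "(\<Inter>i\<in>I. r i) \<subseteq> S \<times> S" using assms by (fastforce simp: equiv_def)
  show "refl_on S (\<Inter>i\<in>I. r i)" using assms by (fastforce simp: equiv_def refl_on_def)
  show "Relation.sym (\<Inter>i\<in>I. r i)" using assms by (fastforce simp: equiv_def Relation.sym_def)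
  show "Relation.trans (\<Inter>i\<in>I. r i)"
    using assms(2) by (force simp: equiv_def intro!: transI elim: transE)
qed

lemma congruence_generated_congruence:
  assumes "representation F" "S \<subseteq> sort_pairs F"
  shows "congruence F (generated_congruence F S)"
proof -
  let ?I = "{R. congruence F R \<and> S \<subseteq> R}"
  have ne: "?I \<noteq> {}" using congruence_sort_pairs assms by blast
  have "Inl -` \<Inter>?I = (\<Inter>R\<in>?I. Inl -` R)" "Inr -` \<Inter>?I = (\<Inter>R\<in>?I. Inr -` R)" by auto
  then have "equiv (carrier (grp F)) (Inl -` \<Inter>?I)" "equiv (carrier (vecs F)) (Inr -` \<Inter>?I)"
    using equiv_INT[OF ne, of "carrier (grp F)" "\<lambda>R. Inl -` R"]
      equiv_INT[OF ne, of "carrier (vecs F)" "\<lambda>R. Inr -` R"]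
    by (auto simp: congruence_def)
  then show ?thesis
    unfolding generated_congruence_def
    by (subst congruence_def) (auto simp: congruence_def)
qed

lemma quotient_op1:
  assumes "equiv S r" "equiv S' r'" "\<And>a b. (a, b) \<in> r \<Longrightarrow> (f a, f b) \<in> r'" "a \<in> S"
  shows "(\<Union>a\<in>r `` {a}. r' `` {f a}) = r' `` {f a}"
  by (rule UN_equiv_class[OF assms(1) _ assms(4)])
    (auto simp: congruent_def intro!: equiv_class_eq[OF assms(2)] assms(3))

lemma quotient_op2:
  assumes "equiv S1 r1" "equiv S2 r2" "equiv S' r'"
    and "\<And>a b c d. (a, b) \<in> r1 \<Longrightarrow> (c, d) \<in> r2 \<Longrightarrow> (f a c, f b d) \<in> r'"
    and "a \<in> S1" "c \<in> S2"
  shows "(\<Union>a\<in>r1 `` {a}. \<Union>c\<in>r2 `` {c}. r' `` {f a c}) = r' `` {f a c}"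
  by (rule UN_equiv_class2[OF assms(1,2) _ assms(5,6)])
    (auto simp: congruent2_def intro!: equiv_class_eq[OF assms(3)] assms(4))

lemma representation_quotient_rep:
  fixes F :: "('k::field, 'g, 'v) rep"
  assumes F: "representation F" and R: "congruence F R"
  shows "representation (quotient_rep F R)"
proof -
  interpret G: group "grp F" using F by (simp add: representation_def)
  interpret V: module ring_of_type_algebra "vecs F" using F by (simp add: representation_def)
  let ?Q = "quotient_rep F R" and ?r = "Inl -` R" and ?s = "Inr -` R"
  let ?G = "carrier (grp F)" and ?V = "carrier (vecs F)"
  have r: "equiv ?G ?r" and s: "equiv ?V ?s" using R by (auto simp: congruence_def)
  have Gcase: "\<exists>a\<in>?G. A = ?r `` {a}" if "A \<in> carrier (grp ?Q)" for A
    using that by (auto simp: quotient_rep_def elim!: quotientE)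
  have Vcase: "\<exists>a\<in>?V. A = ?s `` {a}" if "A \<in> carrier (vecs ?Q)" for A
    using that by (auto simp: quotient_rep_def elim!: quotientE)
  have Gcl: "?r `` {a} \<in> carrier (grp ?Q)" if "a \<in> ?G" for a
    using that by (auto simp: quotient_rep_def intro: quotientI)
  have Vcl: "?s `` {a} \<in> carrier (vecs ?Q)" if "a \<in> ?V" for a
    using that by (auto simp: quotient_rep_def intro: quotientI)
  have mult: "?r `` {a} \<otimes>\<^bsub>grp ?Q\<^esub> ?r `` {b} = ?r `` {a \<otimes>\<^bsub>grp F\<^esub> b}" if "a \<in> ?G" "b \<in> ?G" for a b
    using quotient_op2[OF r r r _ that, of "monoid.mult (grp F)"] R
    by (simp add: quotient_rep_def congruence_def)
  have add: "?s `` {a} \<oplus>\<^bsub>vecs ?Q\<^esub> ?s `` {b} = ?s `` {a \<oplus>\<^bsub>vecs F\<^esub> b}" if "a \<in> ?V" "b \<in> ?V" for a b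
    using quotient_op2[OF s s s _ that, of "ring.add (vecs F)"] R
    by (simp add: quotient_rep_def congruence_def)
  have smul: "c \<odot>\<^bsub>vecs ?Q\<^esub> ?s `` {a} = ?s `` {c \<odot>\<^bsub>vecs F\<^esub> a}" if "a \<in> ?V" for c a
    using quotient_op1[OF s s _ that, of "module.smult (vecs F) c"] R
    by (simp add: quotient_rep_def congruence_def)
  have actq: "act ?Q (?r `` {g}) (?s `` {v}) = ?s `` {act F g v}" if "g \<in> ?G" "v \<in> ?V" for g v
    using quotient_op2[OF r s s _ that, of "act F"] R
    by (simp add: quotient_rep_def congruence_def)
  have one: "\<one>\<^bsub>grp ?Q\<^esub> = ?r `` {\<one>\<^bsub>grp F\<^esub>}" and zero: "\<zero>\<^bsub>vecs ?Q\<^esub> = ?s `` {\<zero>\<^bsub>vecs F\<^esub>}"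
    by (simp_all add: quotient_rep_def)
  have sc: "c \<odot>\<^bsub>vecs F\<^esub> v \<in> ?V" if "v \<in> ?V" for c v
    using that V.smult_closed[of c v] by simp
  have lin: "act F g v \<in> ?V"
    "act F g (v \<oplus>\<^bsub>vecs F\<^esub> w) = act F g v \<oplus>\<^bsub>vecs F\<^esub> act F g w"
    "act F g (c \<odot>\<^bsub>vecs F\<^esub> v) = c \<odot>\<^bsub>vecs F\<^esub> act F g v"
    if "g \<in> ?G" "v \<in> ?V" "w \<in> ?V" for g v w c
    using that F by (auto simp: representation_def linear_maps_def hom_def)
  have "group (grp ?Q)"
  proof (rule groupI)
    fix A B C assume "A \<in> carrier (grp ?Q)" "B \<in> carrier (grp ?Q)" "C \<in> carrier (grp ?Q)"
    then show "A \<otimes>\<^bsub>grp ?Q\<^esub> B \<otimes>\<^bsub>grp ?Q\<^esub> C = A \<otimes>\<^bsub>grp ?Q\<^esub> (B \<otimes>\<^bsub>grp ?Q\<^esub> C)"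
      by (auto dest!: Gcase simp: mult G.m_assoc)
  next
    fix A assume "A \<in> carrier (grp ?Q)"
    then obtain a where a: "a \<in> ?G" "A = ?r `` {a}" using Gcase by blast
    then show "\<exists>B\<in>carrier (grp ?Q). B \<otimes>\<^bsub>grp ?Q\<^esub> A = \<one>\<^bsub>grp ?Q\<^esub>"
      by (intro bexI[of _ "?r `` {inv\<^bsub>grp F\<^esub> a}"]) (auto simp: mult one Gcl)
  qed (auto dest!: Gcase simp: mult one Gcl)
  moreover have "module ring_of_type_algebra (vecs ?Q)"
  proof (rule moduleI)
    show "abelian_group (vecs ?Q)"
    proof (rule abelian_groupI)
      fix A B C assume "A \<in> carrier (vecs ?Q)" "B \<in> carrier (vecs ?Q)" "C \<in> carrier (vecs ?Q)"
      then show "A \<oplus>\<^bsub>vecs ?Q\<^esub> B \<oplus>\<^bsub>vecs ?Q\<^esub> C = A \<oplus>\<^bsub>vecs ?Q\<^esub> (B \<oplus>\<^bsub>vecs ?Q\<^esub> C)"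
        by (auto dest!: Vcase simp: add V.a_assoc)
    next
      fix A B assume "A \<in> carrier (vecs ?Q)" "B \<in> carrier (vecs ?Q)"
      then show "A \<oplus>\<^bsub>vecs ?Q\<^esub> B = B \<oplus>\<^bsub>vecs ?Q\<^esub> A"
        by (auto dest!: Vcase simp: add V.a_comm)
    next
      fix A assume "A \<in> carrier (vecs ?Q)"
      then obtain a where a: "a \<in> ?V" "A = ?s `` {a}" using Vcase by blast
      then show "\<exists>B\<in>carrier (vecs ?Q). B \<oplus>\<^bsub>vecs ?Q\<^esub> A = \<zero>\<^bsub>vecs ?Q\<^esub>"
        by (intro bexI[of _ "?s `` {\<ominus>\<^bsub>vecs F\<^esub> a}"]) (auto simp: add zero Vcl V.l_neg)
    qed (auto dest!: Vcase simp: add zero Vcl)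
    show "cring (ring_of_type_algebra :: 'k ring)" by (rule V.R.is_cring)
  next
    fix a b :: 'k and A assume "A \<in> carrier (vecs ?Q)"
    then obtain v where v: "v \<in> ?V" "A = ?s `` {v}" using Vcase by blast
    show "(a \<oplus>\<^bsub>ring_of_type_algebra\<^esub> b) \<odot>\<^bsub>vecs ?Q\<^esub> A
        = a \<odot>\<^bsub>vecs ?Q\<^esub> A \<oplus>\<^bsub>vecs ?Q\<^esub> b \<odot>\<^bsub>vecs ?Q\<^esub> A"
      using v V.smult_l_distr[of a b v] by (simp add: smul add sc)
    show "(a \<otimes>\<^bsub>ring_of_type_algebra\<^esub> b) \<odot>\<^bsub>vecs ?Q\<^esub> A = a \<odot>\<^bsub>vecs ?Q\<^esub> (b \<odot>\<^bsub>vecs ?Q\<^esub> A)"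
      using v V.smult_assoc1[of a b v] by (simp add: smul sc)
  next
    fix a :: 'k and A B assume "A \<in> carrier (vecs ?Q)" "B \<in> carrier (vecs ?Q)"
    then obtain v w where vw: "v \<in> ?V" "A = ?s `` {v}" "w \<in> ?V" "B = ?s `` {w}"
      using Vcase by meson
    show "a \<odot>\<^bsub>vecs ?Q\<^esub> (A \<oplus>\<^bsub>vecs ?Q\<^esub> B) = a \<odot>\<^bsub>vecs ?Q\<^esub> A \<oplus>\<^bsub>vecs ?Q\<^esub> a \<odot>\<^bsub>vecs ?Q\<^esub> B"
      using vw V.smult_r_distr[of a v w] by (simp add: smul add sc)
  next
    fix A assume "A \<in> carrier (vecs ?Q)"
    then obtain v where v: "v \<in> ?V" "A = ?s `` {v}" using Vcase by blast
    then show "\<one>\<^bsub>ring_of_type_algebra\<^esub> \<odot>\<^bsub>vecs ?Q\<^esub> A = A"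
      using V.smult_one[of v] by (simp add: smul)
  qed (auto dest!: Vcase simp: smul Vcl sc)
  moreover have "act ?Q A \<in> linear_maps (vecs ?Q) (vecs ?Q)" if "A \<in> carrier (grp ?Q)" for A
    using Gcase[OF that] unfolding linear_maps_def
    by (auto intro!: group_homI dest!: Vcase simp: actq add smul lin Vcl sc)
  moreover have "act ?Q \<one>\<^bsub>grp ?Q\<^esub> B = B" if "B \<in> carrier (vecs ?Q)" for B
    using Vcase[OF that] F by (auto simp: one actq representation_def)
  moreover have "act ?Q (A \<otimes>\<^bsub>grp ?Q\<^esub> A') B = act ?Q A (act ?Q A' B)"
    if "A \<in> carrier (grp ?Q)" "A' \<in> carrier (grp ?Q)" "B \<in> carrier (vecs ?Q)" for A A' B
    using Gcase[OF that(1)] Gcase[OF that(2)] Vcase[OF that(3)] F lin(1)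
    by (auto simp: mult actq representation_def)
  ultimately show ?thesis by (simp add: representation_def)
qed

lemma representation_twist:
  fixes H :: "('k::field, 'g, 'v) rep"
  assumes H: "representation H"
    and \<phi>: "\<phi> \<in> ring_iso ring_of_type_algebra (ring_of_type_algebra :: 'k ring)"
  shows "representation (twist \<phi> H)"
proof -
  interpret V: module ring_of_type_algebra "vecs H" using H by (simp add: representation_def)
  have hom: "\<phi> (a + b) = \<phi> a + \<phi> b" "\<phi> (a * b) = \<phi> a * \<phi> b" "\<phi> 1 = 1" for a b
    using \<phi> by (auto simp: ring_iso_def ring_hom_def)
  have "module ring_of_type_algebra (vecs (twist \<phi> H))"
  proof (rule moduleI)
    show "abelian_group (vecs (twist \<phi> H))"
    proof (rule abelian_groupI)
      fix x assume "x \<in> carrier (vecs (twist \<phi> H))"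
      then show "\<exists>y\<in>carrier (vecs (twist \<phi> H)).
          y \<oplus>\<^bsub>vecs (twist \<phi> H)\<^esub> x = \<zero>\<^bsub>vecs (twist \<phi> H)\<^esub>"
        by (intro bexI[of _ "\<ominus>\<^bsub>vecs H\<^esub> x"]) (auto simp: twist_def V.l_neg)
    qed (auto simp: twist_def V.a_ac)
    show "cring (ring_of_type_algebra :: 'k ring)" by (rule V.R.is_cring)
  next
    fix a b :: 'k and x assume x: "x \<in> carrier (vecs (twist \<phi> H))"
    then have x: "x \<in> carrier (vecs H)" by (simp add: twist_def)
    show "a \<odot>\<^bsub>vecs (twist \<phi> H)\<^esub> x \<in> carrier (vecs (twist \<phi> H))"
      using x V.smult_closed[of "\<phi> a" x] by (simp add: twist_def)
    show "(a \<oplus>\<^bsub>ring_of_type_algebra\<^esub> b) \<odot>\<^bsub>vecs (twist \<phi> H)\<^esub> x =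
       a \<odot>\<^bsub>vecs (twist \<phi> H)\<^esub> x \<oplus>\<^bsub>vecs (twist \<phi> H)\<^esub> b \<odot>\<^bsub>vecs (twist \<phi> H)\<^esub> x"
      using x V.smult_l_distr[of "\<phi> a" "\<phi> b" x] by (simp add: twist_def hom)
    show "(a \<otimes>\<^bsub>ring_of_type_algebra\<^esub> b) \<odot>\<^bsub>vecs (twist \<phi> H)\<^esub> x =
       a \<odot>\<^bsub>vecs (twist \<phi> H)\<^esub> (b \<odot>\<^bsub>vecs (twist \<phi> H)\<^esub> x)"
      using x V.smult_assoc1[of "\<phi> a" "\<phi> b" x] by (simp add: twist_def hom)
    show "\<one>\<^bsub>ring_of_type_algebra\<^esub> \<odot>\<^bsub>vecs (twist \<phi> H)\<^esub> x = x"
      using x V.smult_one[of x] by (simp add: twist_def hom)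
    fix y assume "y \<in> carrier (vecs (twist \<phi> H))"
    then show "a \<odot>\<^bsub>vecs (twist \<phi> H)\<^esub> (x \<oplus>\<^bsub>vecs (twist \<phi> H)\<^esub> y) =
       a \<odot>\<^bsub>vecs (twist \<phi> H)\<^esub> x \<oplus>\<^bsub>vecs (twist \<phi> H)\<^esub> a \<odot>\<^bsub>vecs (twist \<phi> H)\<^esub> y"
      using x V.smult_r_distr[of "\<phi> a" x y] by (simp add: twist_def)
  qed
  then show ?thesis
    using H by (auto simp: representation_def twist_def linear_maps_def hom_def)
qed

end

theory Submission
  imports Defs
begin

text \<open>
  \<open>H\<close> is the line \<open>k\<close> on which the generator acts as the scalar \<open>\<theta>\<^sub>1\<close>. Hence the relation
  \<open>x \<circ> y = \<theta>\<^sub>1 y\<close> is realised in \<open>H\<close> with \<open>y \<noteq> 0\<close>. In the twisted representation a homomorphism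
  realising it sends \<open>x\<close> to an element that acts on \<open>H\<close> as some power \<open>\<theta>\<^sub>1\<^sup>n\<close>, while \<open>\<theta>\<^sub>1\<close> acts
  there as \<open>\<theta>\<^sub>2\<close>; since \<open>\<theta>\<^sub>1\<^sup>n \<noteq> \<theta>\<^sub>2\<close>, the image of \<open>y\<close> is \<open>0\<close>. So the pair \<open>(y, 0)\<close> lies in one
  closure of this relation and not in the other.
\<close>

lemma grp_free_rep [simp]: "grp (free_rep A B) = free_group A"
  by (simp add: free_rep_def)

section \<open>Exponent sums, characters of the free group and the functionals they induce\<close>

definition exponent_sum :: "('x \<times> bool) list \<Rightarrow> int" where
  "exponent_sum u = (\<Sum>(x, b)\<leftarrow>u. if b then 1 else - 1)"

lemma exponent_sum_simps [simp]:
  "exponent_sum [] = 0"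
  "exponent_sum ((x, b) # u) = (if b then 1 else - 1) + exponent_sum u"
  "exponent_sum (u @ v) = exponent_sum u + exponent_sum v"
  by (simp_all add: exponent_sum_def)

text \<open>The letters \<open>(x, b)\<close> and \<open>(x, \<not> b)\<close> of a cancelled pair
  contribute 1 and -1 in one order or the other, so the sum descends to classes of words.\<close>

lemma exponent_sum_word_eq: "(u, v) \<in> word_eq A \<Longrightarrow> exponent_sum u = exponent_sum v"
  by (induction rule: word_eq.induct) auto

text \<open>For nonzero \<open>t\<close> this is the character of the free group that sends every
  generator to \<open>t\<close>. \<open>SOME\<close> picks a word from the class; since the exponent
  sum is constant on classes, the choice does not affect the value.\<close>

definition weight :: "'k::field \<Rightarrow> ('x \<times> bool) list set \<Rightarrow> 'k" where
  "weight t g = t powi exponent_sum (SOME u. u \<in> g)"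

lemma weight_class:
  assumes "u \<in> lists (A \<times> UNIV)"
  shows "weight t (word_eq A `` {u}) = t powi exponent_sum u"
proof -
  have "u \<in> word_eq A `` {u}" using assms by (auto intro: word_eq.refl)
  then have "(SOME v. v \<in> word_eq A `` {u}) \<in> word_eq A `` {u}" by (rule someI)
  then show ?thesis by (auto simp: weight_def dest: exponent_sum_word_eq)
qed

text \<open>Words concatenate and exponent sums add. Nonzero \<open>t\<close> makes the power law
  valid for exponents of opposite sign: \<open>0 powi 1 * 0 powi (- 1)\<close> is 0 while
  \<open>0 powi 0\<close> is 1.\<close>

lemma weight_mult:
  assumes "t \<noteq> 0" "g \<in> carrier (free_group A)" "h \<in> carrier (free_group A)"
  shows "weight t (g \<otimes>\<^bsub>free_group A\<^esub> h) = weight t g * weight t h"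
proof -
  obtain u where u: "u \<in> lists (A \<times> UNIV)" "g = word_eq A `` {u}"
    using assms(2) by (rule free_group_cases)
  obtain v where "v \<in> lists (A \<times> UNIV)" "h = word_eq A `` {v}"
    using assms(3) by (rule free_group_cases)
  with u show ?thesis
    using assms(1)
    by (simp add: free_group_mult weight_class power_int_add append_in_lists_conv
        del: in_lists_conv_set)
qed

lemma weight_one [simp]: "weight t \<one>\<^bsub>free_group A\<^esub> = 1"
  by (simp add: free_group_one weight_class)

text \<open>The linear map \<open>h \<circ> y \<mapsto> t\<^sup>n\<close>, where \<open>n\<close> is the exponent sum of \<open>h\<close>.\<close>

definition specialize :: "'k::field \<Rightarrow> (('x \<times> bool) list set \<times> 'y \<Rightarrow> 'k) \<Rightarrow> 'k" where
  "specialize t f = (\<Sum>p | f p \<noteq> 0. f p * weight t (fst p))"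

text \<open>The support of \<open>f\<close> changes under addition and under scaling by 0. Summing
  over a fixed finite set allows a comparison term by term.\<close>

lemma specialize_superset:
  assumes "finite S" "{p. f p \<noteq> 0} \<subseteq> S"
  shows "specialize t f = (\<Sum>p\<in>S. f p * weight t (fst p))"
  unfolding specialize_def using assms by (intro sum.mono_neutral_left) auto

lemma specialize_add:
  assumes "f \<in> carrier (vecs (free_rep A B))" "f' \<in> carrier (vecs (free_rep A B))"
  shows "specialize t (f \<oplus>\<^bsub>vecs (free_rep A B)\<^esub> f') = specialize t f + specialize t f'"
proof -
  let ?S = "{p. f p \<noteq> 0} \<union> {p. f' p \<noteq> 0}"
  have S: "finite ?S" using assms by (simp add: free_rep_def)
  have "specialize t (\<lambda>p. f p + f' p) = (\<Sum>p\<in>?S. (f p + f' p) * weight t (fst p))"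
    by (rule specialize_superset[OF S]) auto
  also have "\<dots> = specialize t f + specialize t f'"
    by (subst (1 2) specialize_superset[OF S]) (auto simp: algebra_simps sum.distrib)
  finally show ?thesis by (simp add: free_rep_def)
qed

lemma specialize_smult:
  assumes "f \<in> carrier (vecs (free_rep A B))"
  shows "specialize t (c \<odot>\<^bsub>vecs (free_rep A B)\<^esub> f) = c * specialize t f"
proof -
  have S: "finite {p. f p \<noteq> 0}" using assms by (simp add: free_rep_def)
  have "specialize t (\<lambda>p. c * f p) = (\<Sum>p | f p \<noteq> 0. (c * f p) * weight t (fst p))"
    by (rule specialize_superset[OF S]) auto
  also have "\<dots> = c * specialize t f"
    by (simp add: specialize_def sum_distrib_left mult.assoc)
  finally show ?thesis by (simp add: free_rep_def)
qed

text \<open>The action translates the support of \<open>f\<close> by \<open>g\<close>, so the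
  substitution of \<open>g h\<close> for \<open>h\<close> in the sum pulls out the factor
  \<open>weight t g\<close>. Thus \<open>specialize t\<close> is equivariant onto the line on which
  \<open>g\<close> acts as the scalar \<open>weight t g\<close>.\<close>

lemma specialize_act:
  assumes t: "t \<noteq> 0" and g: "g \<in> carrier (free_group A)"
    and f: "f \<in> carrier (vecs (free_rep A B))"
  shows "specialize t (act (free_rep A B) g f) = weight t g * specialize t f"
proof -
  let ?G = "free_group A" and ?f = "act (free_rep A B) g f"
  interpret G: group ?G by (rule group_free_group)
  have dom: "{p. f p \<noteq> 0} \<subseteq> carrier ?G \<times> B" using f by (simp add: free_rep_def)
  have "?f \<in> carrier (vecs (free_rep A B))"
    using g f by (intro act_free_rep_carrier) (auto simp: free_rep_def)
  \<comment> \<open>Translations by \<open>g\<close> and by its inverse cancel on group elements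
    only, so both supports have to lie over the carrier of the group.\<close>
  then have dom': "{p. ?f p \<noteq> 0} \<subseteq> carrier ?G \<times> B" by (simp add: free_rep_def)
  have inv: "inv\<^bsub>?G\<^esub> g \<otimes>\<^bsub>?G\<^esub> (g \<otimes>\<^bsub>?G\<^esub> h) = h" "g \<otimes>\<^bsub>?G\<^esub> (inv\<^bsub>?G\<^esub> g \<otimes>\<^bsub>?G\<^esub> h) = h"
    if "h \<in> carrier ?G" for h
    using g that by (simp_all add: G.m_assoc[symmetric])
  have val: "?f (h, y) = f (inv\<^bsub>?G\<^esub> g \<otimes>\<^bsub>?G\<^esub> h, y)" if "h \<in> carrier ?G" for h y
    using that by (simp add: free_rep_def)
  have "specialize t ?f = (\<Sum>p | f p \<noteq> 0. weight t g * (f p * weight t (fst p)))"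
    unfolding specialize_def
  proof (rule sum.reindex_bij_witness[where
        i = "\<lambda>(h, y). (g \<otimes>\<^bsub>?G\<^esub> h, y)" and j = "\<lambda>(h, y). (inv\<^bsub>?G\<^esub> g \<otimes>\<^bsub>?G\<^esub> h, y)"])
    fix p assume p: "p \<in> {p. ?f p \<noteq> 0}"
    then obtain h y where hy: "p = (h, y)" "h \<in> carrier ?G" using dom' by auto
    show "(case case p of (h, y) \<Rightarrow> (inv\<^bsub>?G\<^esub> g \<otimes>\<^bsub>?G\<^esub> h, y) of
      (h, y) \<Rightarrow> (g \<otimes>\<^bsub>?G\<^esub> h, y)) = p" using hy by (simp add: inv)
    show "(case p of (h, y) \<Rightarrow> (inv\<^bsub>?G\<^esub> g \<otimes>\<^bsub>?G\<^esub> h, y)) \<in> {p. f p \<noteq> 0}"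
      using p hy val by simp
    show "weight t g * (f (case p of (h, y) \<Rightarrow> (inv\<^bsub>?G\<^esub> g \<otimes>\<^bsub>?G\<^esub> h, y)) *
        weight t (fst (case p of (h, y) \<Rightarrow> (inv\<^bsub>?G\<^esub> g \<otimes>\<^bsub>?G\<^esub> h, y)))) = ?f p * weight t (fst p)"
      using hy val g weight_mult[OF t g, of "inv\<^bsub>?G\<^esub> g \<otimes>\<^bsub>?G\<^esub> h"] by (simp add: inv)
  next
    fix p assume p: "p \<in> {p. f p \<noteq> 0}"
    then obtain h y where hy: "p = (h, y)" "h \<in> carrier ?G" using dom by auto
    show "(case case p of (h, y) \<Rightarrow> (g \<otimes>\<^bsub>?G\<^esub> h, y) of
      (h, y) \<Rightarrow> (inv\<^bsub>?G\<^esub> g \<otimes>\<^bsub>?G\<^esub> h, y)) = p" using hy by (simp add: inv)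
    show "(case p of (h, y) \<Rightarrow> (g \<otimes>\<^bsub>?G\<^esub> h, y)) \<in> {p. ?f p \<noteq> 0}"
      using p hy val g by (simp add: inv)
  qed
  then show ?thesis by (simp add: specialize_def sum_distrib_left)
qed

lemma specialize_vec_gen [simp]: "specialize t (vec_gen A y) = 1"
proof -
  have "{p. (vec_gen A y :: _ \<Rightarrow> 'a) p \<noteq> 0} = {(\<one>\<^bsub>free_group A\<^esub>, y)}"
    by (auto simp: vec_gen_def)
  then show ?thesis by (simp add: specialize_def) (simp add: vec_gen_def)
qed

lemma specialize_zero [simp]: "specialize t (\<lambda>p. 0) = 0"
  by (simp add: specialize_def)

section \<open>The congruence generated by a generator acting as a scalar\<close>

text \<open>This is equality on groups together with the kernel of an equivariant linear functional.
  It serves as the upper bound for the generated congruence.\<close>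

lemma congruence_specialize:
  fixes t :: "'k::field"
  assumes t: "t \<noteq> 0"
  shows "congruence (free_rep A B)
    ({(g, h). g \<in> carrier (free_group A) \<and> g = h} <+>
     {(v, w). v \<in> carrier (vecs (free_rep A B)) \<and> w \<in> carrier (vecs (free_rep A B)) \<and>
       specialize t v = specialize t w})"
proof -
  let ?F = "free_rep A B :: ('k, _, _) rep"
  have F: "representation ?F" by (rule representation_free_rep)
  interpret G: group "free_group A" by (rule group_free_group)
  interpret V: module ring_of_type_algebra "vecs ?F" using F by (simp add: representation_def)
  have zero: "\<zero>\<^bsub>vecs ?F\<^esub> = (\<lambda>p. 0)" by (simp add: free_rep_def)
  \<comment> \<open>Additivity is applied to the sum of \<open>v\<close> and its negative, whose
    specialization is 0.\<close>
  have neg: "specialize t (\<ominus>\<^bsub>vecs ?F\<^esub> v) = - specialize t v" if "v \<in> carrier (vecs ?F)" for v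
    using specialize_add[of v A B "\<ominus>\<^bsub>vecs ?F\<^esub> v" t] that
    by (simp add: V.r_neg zero eq_neg_iff_add_eq_0 add.commute)
  have cl: "act ?F g v \<in> carrier (vecs ?F)" "c \<odot>\<^bsub>vecs ?F\<^esub> v \<in> carrier (vecs ?F)"
    if "g \<in> carrier (free_group A)" "v \<in> carrier (vecs ?F)" for g v c
    using act_free_rep_carrier[of g A B v] that V.smult_closed[of c v] by simp_all
  show ?thesis
    unfolding congruence_def
    by (auto simp: equiv_def refl_on_def Relation.sym_def Relation.trans_def neg
        specialize_add specialize_smult specialize_act[OF t] cl)
qed

text \<open>By induction on a word for \<open>g\<close>, each letter acting on \<open>e\<close> can
  be traded modulo \<open>R\<close> for the scalar \<open>t\<close> or its inverse, and scalars
  commute with the action.\<close>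

lemma free_rep_basis_reduction:
  fixes t :: "'k::field" and x :: 'x and y :: 'y
  defines "F \<equiv> free_rep {x} {y} :: ('k, _, _) rep" and "e \<equiv> vec_gen {x} y :: _ \<Rightarrow> 'k"
  assumes t: "t \<noteq> 0" and R: "congruence F R"
    and rel: "Inr (act F (group_gen {x} x) e, t \<odot>\<^bsub>vecs F\<^esub> e) \<in> R"
    and g: "g \<in> carrier (free_group {x})"
  shows "Inr (act F g e, weight t g \<odot>\<^bsub>vecs F\<^esub> e) \<in> R"
proof -
  let ?G = "free_group {x}"
  interpret G: group ?G by (rule group_free_group)
  have F: "representation F" unfolding F_def by (rule representation_free_rep)
  interpret V: module ring_of_type_algebra "vecs F" using F by (simp add: representation_def)
  have grp [simp]: "grp F = ?G" by (simp add: F_def)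
  have e: "e \<in> carrier (vecs F)" unfolding e_def F_def by (rule gens_in_free_rep) simp
  have ss: "c \<odot>\<^bsub>vecs F\<^esub> (d \<odot>\<^bsub>vecs F\<^esub> v) = (c * d) \<odot>\<^bsub>vecs F\<^esub> v"
    if "v \<in> carrier (vecs F)" for c d v
    using that V.smult_assoc1[of c d v] by simp
  have s1: "1 \<odot>\<^bsub>vecs F\<^esub> v = v" if "v \<in> carrier (vecs F)" for v
    using that V.smult_one[of v] by simp
  have lin: "act F h (c \<odot>\<^bsub>vecs F\<^esub> v) = c \<odot>\<^bsub>vecs F\<^esub> act F h v" "act F h v \<in> carrier (vecs F)"
    "act F (h \<otimes>\<^bsub>?G\<^esub> h') v = act F h (act F h' v)" "act F \<one>\<^bsub>?G\<^esub> v = v"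
    if "h \<in> carrier ?G" "h' \<in> carrier ?G" "v \<in> carrier (vecs F)" for h h' v c
    using that F by (auto simp: representation_def linear_maps_def hom_def)
  have eqv: "equiv (carrier (vecs F)) (Inr -` R)" "equiv (carrier ?G) (Inl -` R)"
    using R by (auto simp: congruence_def)
  have Rrefl: "Inr (v, v) \<in> R" if "v \<in> carrier (vecs F)" for v
    using that eqv(1) by (auto simp: equiv_def refl_on_def)
  have Rsym: "Inr (w, v) \<in> R" if "Inr (v, w) \<in> R" for v w
    using that eqv(1) by (auto simp: equiv_def Relation.sym_def)
  have Rtrans: "Inr (v, u) \<in> R" if "Inr (v, w) \<in> R" "Inr (w, u) \<in> R" for v w u
    using that eqv(1) unfolding equiv_def Relation.trans_def by blast
  have Rsmult: "Inr (c \<odot>\<^bsub>vecs F\<^esub> v, c \<odot>\<^bsub>vecs F\<^esub> w) \<in> R" if "Inr (v, w) \<in> R" for c v w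
    using that R by (auto simp: congruence_def)
  have Ract: "Inr (act F h v, act F h w) \<in> R" if "h \<in> carrier ?G" "Inr (v, w) \<in> R" for h v w
    using that R eqv(2) by (auto simp: congruence_def equiv_def refl_on_def)
  let ?x = "\<lambda>b. word_eq {x} `` {[(x, b)]}"
  have x: "?x b \<in> carrier ?G" for b by (rule free_group_class) simp
  have letter: "Inr (act F (?x b) e, (t powi (if b then 1 else - 1)) \<odot>\<^bsub>vecs F\<^esub> e) \<in> R" for b
  proof (cases b)
    case True
    then show ?thesis using rel by (simp add: group_gen_def)
  next
    case False
    have "([(x, False), (x, True)], []) \<in> word_eq {x}"
      using word_eq.cancel[of "[]" "{x}" "[]" x False] by simp
    then have "?x False \<otimes>\<^bsub>?G\<^esub> ?x True = \<one>\<^bsub>?G\<^esub>"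
      by (simp add: free_group_mult free_group_one equiv_class_eq[OF equiv_word_eq])
    then have "act F (?x False) (act F (?x True) e) = e"
      using lin(3,4) x e by metis
    \<comment> \<open>The inverse letter is applied to both sides of the given relation. Scaling by
      \<open>inverse t\<close> then isolates the action of that letter on \<open>e\<close>.\<close>
    then have "Inr (e, t \<odot>\<^bsub>vecs F\<^esub> act F (?x False) e) \<in> R"
      using Ract[OF x rel, of False] lin(1)[OF x x e] by (simp add: group_gen_def)
    from Rsmult[OF Rsym[OF this], of "inverse t"] show ?thesis
      using False t ss s1 lin(2)[OF x x e] by (simp add: power_int_minus)
  qed
  have "Inr (act F (word_eq {x} `` {u}) e, t powi exponent_sum u \<odot>\<^bsub>vecs F\<^esub> e) \<in> R"
    if "u \<in> lists ({x} \<times> UNIV)" for u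
    using that
  proof (induction u)
    case Nil
    then show ?case using Rrefl[OF e] lin(4)[OF x x e] s1[OF e]
      by (simp add: free_group_one)
  next
    case (Cons p u)
    then obtain b where p: "p = (x, b)" and u: "u \<in> lists ({x} \<times> UNIV)" by auto
    let ?u = "word_eq {x} `` {u}"
    have uc: "?u \<in> carrier ?G" using u by (rule free_group_class)
    have "word_eq {x} `` {p # u} = ?x b \<otimes>\<^bsub>?G\<^esub> ?u"
      using u p by (simp add: free_group_mult del: in_lists_conv_set)
    then have 1: "act F (word_eq {x} `` {p # u}) e = act F (?x b) (act F ?u e)"
      using lin(3)[OF x uc e] by simp
    \<comment> \<open>The letter acts on the induction hypothesis and moves past the scalar; the
      next step evaluates it on \<open>e\<close> by \<open>letter\<close>.\<close>
    have 2: "Inr (act F (?x b) (act F ?u e), t powi exponent_sum u \<odot>\<^bsub>vecs F\<^esub> act F (?x b) e) \<in> R"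
      using Ract[OF x Cons.IH, of b] lin(1)[OF x x e] by simp
    have 3: "Inr (t powi exponent_sum u \<odot>\<^bsub>vecs F\<^esub> act F (?x b) e,
        t powi exponent_sum (p # u) \<odot>\<^bsub>vecs F\<^esub> e) \<in> R"
      using Rsmult[OF letter, of "t powi exponent_sum u" b] ss[OF e] t p
      by (simp add: power_int_add mult.commute)
    show ?case unfolding 1 by (rule Rtrans[OF 2 3])
  qed
  moreover obtain u where "u \<in> lists ({x} \<times> UNIV)" "g = word_eq {x} `` {u}"
    using g by (rule free_group_cases)
  ultimately show ?thesis by (simp add: weight_class del: in_lists_conv_set)
qed

text \<open>The vectors \<open>g\<close> acting on \<open>e\<close> span the module, and each is
  congruent to a multiple of \<open>e\<close>; so modulo \<open>R\<close> the vector sort is at most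
  a line. The induction removes one point of the support at a time.\<close>

lemma free_rep_reduction:
  fixes t :: "'k::field" and x :: 'x and y :: 'y
  defines "F \<equiv> free_rep {x} {y} :: ('k, _, _) rep" and "e \<equiv> vec_gen {x} y :: _ \<Rightarrow> 'k"
  assumes t: "t \<noteq> 0" and R: "congruence F R"
    and rel: "Inr (act F (group_gen {x} x) e, t \<odot>\<^bsub>vecs F\<^esub> e) \<in> R"
    and v: "v \<in> carrier (vecs F)"
  shows "\<exists>c. Inr (v, c \<odot>\<^bsub>vecs F\<^esub> e) \<in> R"
proof -
  let ?G = "free_group {x}"
  interpret G: group ?G by (rule group_free_group)
  have ops: "\<zero>\<^bsub>vecs F\<^esub> = (\<lambda>p. 0)" "c \<odot>\<^bsub>vecs F\<^esub> f = (\<lambda>p. c * f p)"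
    "f \<oplus>\<^bsub>vecs F\<^esub> f' = (\<lambda>p. f p + f' p)" for c f f'
    by (simp_all add: F_def free_rep_def)
  have eqv: "equiv (carrier (vecs F)) (Inr -` R)"
    using R by (auto simp: congruence_def)
  have "\<exists>c. Inr (v, c \<odot>\<^bsub>vecs F\<^esub> e) \<in> R"
    if "finite S" "{p. v p \<noteq> 0} = S" "S \<subseteq> carrier ?G \<times> {y}" for S v
    using that
  proof (induction S arbitrary: v rule: finite_induct)
    case empty
    then have "v = \<zero>\<^bsub>vecs F\<^esub>" by (auto simp: ops)
    moreover have "\<zero>\<^bsub>vecs F\<^esub> \<in> carrier (vecs F)" by (simp add: F_def free_rep_def)
    then have "Inr (\<zero>\<^bsub>vecs F\<^esub>, \<zero>\<^bsub>vecs F\<^esub>) \<in> R"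
      using eqv by (auto simp: equiv_def refl_on_def)
    ultimately show ?case by (intro exI[of _ 0]) (simp add: ops)
  next
    case (insert p S)
    from insert.prems obtain g where p: "p = (g, y)" and g: "g \<in> carrier ?G" by auto
    have "{q. (v(p := 0)) q \<noteq> 0} = {q. v q \<noteq> 0} - {p}" by auto
    then have "{q. (v(p := 0)) q \<noteq> 0} = S" using insert by simp
    then obtain c where c: "Inr (v(p := 0), c \<odot>\<^bsub>vecs F\<^esub> e) \<in> R"
      using insert.IH insert.prems(2) by blast
    have d: "Inr (v p \<odot>\<^bsub>vecs F\<^esub> act F g e, v p \<odot>\<^bsub>vecs F\<^esub> (weight t g \<odot>\<^bsub>vecs F\<^esub> e)) \<in> R"
      using free_rep_basis_reduction[OF t R[unfolded F_def] rel[unfolded F_def e_def] g] R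
      by (auto simp: congruence_def F_def e_def)
    \<comment> \<open>By this equivalence the shifted coefficient function of \<open>e\<close> is
      the indicator of \<open>p\<close>, so \<open>g\<close> acting on \<open>e\<close> is the basis
      vector at \<open>p\<close>.\<close>
    have "inv\<^bsub>?G\<^esub> g \<otimes>\<^bsub>?G\<^esub> h = \<one>\<^bsub>?G\<^esub> \<longleftrightarrow> h = g" if "h \<in> carrier ?G" for h
      using that g by (metis G.inv_closed G.l_inv G.l_cancel)
    then have "act F g e = (\<lambda>q. if q = p then 1 else 0)"
      using g by (auto simp: fun_eq_iff F_def e_def free_rep_def vec_gen_def p)
    then have "v = v(p := 0) \<oplus>\<^bsub>vecs F\<^esub> v p \<odot>\<^bsub>vecs F\<^esub> act F g e"
      by (auto simp: ops)
    moreover have "Inr (v(p := 0) \<oplus>\<^bsub>vecs F\<^esub> v p \<odot>\<^bsub>vecs F\<^esub> act F g e,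
        c \<odot>\<^bsub>vecs F\<^esub> e \<oplus>\<^bsub>vecs F\<^esub> v p \<odot>\<^bsub>vecs F\<^esub> (weight t g \<odot>\<^bsub>vecs F\<^esub> e)) \<in> R"
      using R c d unfolding congruence_def by blast
    moreover have "c \<odot>\<^bsub>vecs F\<^esub> e \<oplus>\<^bsub>vecs F\<^esub> v p \<odot>\<^bsub>vecs F\<^esub> (weight t g \<odot>\<^bsub>vecs F\<^esub> e)
        = (c + v p * weight t g) \<odot>\<^bsub>vecs F\<^esub> e"
      by (auto simp: ops algebra_simps)
    ultimately show ?case by metis
  qed
  then show ?thesis using v by (auto simp: F_def free_rep_def)
qed

text \<open>The kernel of \<open>specialize t\<close> contains the generating pair, which gives one
  direction. Conversely every vector is congruent to a multiple of \<open>e\<close>, and its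
  specialization determines which one. So \<open>specialize t\<close> is a coordinate on the vector
  sort of the quotient, a line spanned by the class of \<open>e\<close>.\<close>

lemma generated_congruence_iff_specialize:
  fixes t :: "'k::field" and x :: 'x and y :: 'y
  defines "F \<equiv> free_rep {x} {y} :: ('k, _, _) rep" and "e \<equiv> vec_gen {x} y :: _ \<Rightarrow> 'k"
  defines "R \<equiv> generated_congruence F {Inr (act F (group_gen {x} x) e, t \<odot>\<^bsub>vecs F\<^esub> e)}"
  assumes t: "t \<noteq> 0" and v: "v \<in> carrier (vecs F)" and w: "w \<in> carrier (vecs F)"
  shows "Inr (v, w) \<in> R \<longleftrightarrow> specialize t v = specialize t w"
proof -
  let ?p = "Inr (act F (group_gen {x} x) e, t \<odot>\<^bsub>vecs F\<^esub> e)"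
  let ?K = "{(g, h). g \<in> carrier (free_group {x}) \<and> g = h} <+>
     {(v, w). v \<in> carrier (vecs F) \<and> w \<in> carrier (vecs F) \<and> specialize t v = specialize t w}"
  have F: "representation F" unfolding F_def by (rule representation_free_rep)
  interpret V: module ring_of_type_algebra "vecs F" using F by (simp add: representation_def)
  have x: "group_gen {x} x \<in> carrier (free_group {x})"
    using gens_in_free_rep(1)[of x "{x}"] by simp
  have e: "e \<in> carrier (vecs F)" unfolding e_def F_def by (rule gens_in_free_rep) simp
  have cl: "act F (group_gen {x} x) e \<in> carrier (vecs F)" "c \<odot>\<^bsub>vecs F\<^esub> e \<in> carrier (vecs F)" for c
    using act_free_rep_carrier[of "group_gen {x} x" "{x}" "{y}" e] x e V.smult_closed[of c e]
    by (simp_all add: F_def)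
  have "weight t (group_gen {x} x) = t" by (simp add: group_gen_def weight_class)
  then have "specialize t (act F (group_gen {x} x) e) = specialize t (t \<odot>\<^bsub>vecs F\<^esub> e)"
    using e specialize_act[OF t x] specialize_smult by (metis F_def)
  then have "?p \<in> ?K" using cl by auto
  moreover have "congruence F ?K" unfolding F_def by (rule congruence_specialize[OF t])
  ultimately have sub: "R \<subseteq> ?K" unfolding R_def generated_congruence_def by blast
  have R: "congruence F R"
    unfolding R_def using cl by (intro congruence_generated_congruence F) (auto simp: sort_pairs_def)
  have rel: "?p \<in> R" by (auto simp: R_def generated_congruence_def)
  have eqv: "equiv (carrier (vecs F)) (Inr -` R)" using R by (auto simp: congruence_def)
  have red: "Inr (u, specialize t u \<odot>\<^bsub>vecs F\<^esub> e) \<in> R" if u: "u \<in> carrier (vecs F)" for u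
  proof -
    obtain c where c: "Inr (u, c \<odot>\<^bsub>vecs F\<^esub> e) \<in> R"
      using free_rep_reduction[OF t R[unfolded F_def] rel[unfolded F_def e_def]] u
      unfolding F_def e_def by blast
    \<comment> \<open>The unknown coefficient \<open>c\<close> is read off by specializing, since
      \<open>e\<close> specializes to 1.\<close>
    with sub have "specialize t u = specialize t (c \<odot>\<^bsub>vecs F\<^esub> e)" by auto
    also have "\<dots> = c" using e specialize_smult[of e "{x}" "{y}" t c] by (simp add: F_def e_def)
    finally show ?thesis using c by simp
  qed
  show ?thesis
  proof
    assume "Inr (v, w) \<in> R"
    then show "specialize t v = specialize t w" using sub by auto
  next
    assume "specialize t v = specialize t w"
    with red[OF v] red[OF w] show "Inr (v, w) \<in> R"
      using eqv unfolding equiv_def Relation.sym_def Relation.trans_def vimage_def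
      by (smt (verit) mem_Collect_eq)
  qed
qed

section \<open>Operations on classes and the natural projection\<close>

lemma quotient_rep_ops:
  fixes F :: "('k::field, 'g, 'v) rep"
  assumes R: "congruence F R"
  shows "g \<in> carrier (grp F) \<Longrightarrow> h \<in> carrier (grp F) \<Longrightarrow>
      (Inl -` R) `` {g} \<otimes>\<^bsub>grp (quotient_rep F R)\<^esub> (Inl -` R) `` {h} = (Inl -` R) `` {g \<otimes>\<^bsub>grp F\<^esub> h}"
    and "v \<in> carrier (vecs F) \<Longrightarrow> w \<in> carrier (vecs F) \<Longrightarrow>
      (Inr -` R) `` {v} \<oplus>\<^bsub>vecs (quotient_rep F R)\<^esub> (Inr -` R) `` {w} = (Inr -` R) `` {v \<oplus>\<^bsub>vecs F\<^esub> w}"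
    and "v \<in> carrier (vecs F) \<Longrightarrow>
      c \<odot>\<^bsub>vecs (quotient_rep F R)\<^esub> (Inr -` R) `` {v} = (Inr -` R) `` {c \<odot>\<^bsub>vecs F\<^esub> v}"
    and "g \<in> carrier (grp F) \<Longrightarrow> v \<in> carrier (vecs F) \<Longrightarrow>
      act (quotient_rep F R) ((Inl -` R) `` {g}) ((Inr -` R) `` {v}) = (Inr -` R) `` {act F g v}"
proof -
  have eqv: "equiv (carrier (grp F)) (Inl -` R)" "equiv (carrier (vecs F)) (Inr -` R)"
    using R by (auto simp: congruence_def)
  show "g \<in> carrier (grp F) \<Longrightarrow> h \<in> carrier (grp F) \<Longrightarrow>
      (Inl -` R) `` {g} \<otimes>\<^bsub>grp (quotient_rep F R)\<^esub> (Inl -` R) `` {h} = (Inl -` R) `` {g \<otimes>\<^bsub>grp F\<^esub> h}"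
    using quotient_op2[OF eqv(1) eqv(1) eqv(1), of "monoid.mult (grp F)"] R
    by (simp add: quotient_rep_def congruence_def)
  show "v \<in> carrier (vecs F) \<Longrightarrow> w \<in> carrier (vecs F) \<Longrightarrow>
      (Inr -` R) `` {v} \<oplus>\<^bsub>vecs (quotient_rep F R)\<^esub> (Inr -` R) `` {w} = (Inr -` R) `` {v \<oplus>\<^bsub>vecs F\<^esub> w}"
    using quotient_op2[OF eqv(2) eqv(2) eqv(2), of "ring.add (vecs F)"] R
    by (simp add: quotient_rep_def congruence_def)
  show "v \<in> carrier (vecs F) \<Longrightarrow>
      c \<odot>\<^bsub>vecs (quotient_rep F R)\<^esub> (Inr -` R) `` {v} = (Inr -` R) `` {c \<odot>\<^bsub>vecs F\<^esub> v}"
    using quotient_op1[OF eqv(2) eqv(2), of "module.smult (vecs F) c"] R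
    by (simp add: quotient_rep_def congruence_def)
  show "g \<in> carrier (grp F) \<Longrightarrow> v \<in> carrier (vecs F) \<Longrightarrow>
      act (quotient_rep F R) ((Inl -` R) `` {g}) ((Inr -` R) `` {v}) = (Inr -` R) `` {act F g v}"
    using quotient_op2[OF eqv(1) eqv(2) eqv(2), of "act F"] R
    by (simp add: quotient_rep_def congruence_def)
qed

lemma quotient_map_rep_hom:
  fixes F :: "('k::field, 'g, 'v) rep"
  assumes F: "representation F" and R: "congruence F R"
  shows "(\<lambda>g. (Inl -` R) `` {g}, \<lambda>v. (Inr -` R) `` {v}) \<in> rep_hom F (quotient_rep F R)"
proof -
  interpret G: group "grp F" using F by (simp add: representation_def)
  interpret V: module ring_of_type_algebra "vecs F" using F by (simp add: representation_def)
  show ?thesis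
    using quotient_rep_ops[OF R]
    by (auto simp: rep_hom_def linear_maps_def hom_def)
      (auto simp: quotient_rep_def intro: quotientI)
qed

section \<open>Powers of one of two algebraically independent elements\<close>

text \<open>An equality would be an algebraic relation: \<open>b - a ^ n = 0\<close> for
  \<open>n \<ge> 0\<close>, and \<open>b * a ^ (- n) - 1 = 0\<close> after clearing the denominator
  for \<open>n < 0\<close>. In the polynomials below the coefficients are polynomials in
  \<open>a\<close>, and the outer variable is \<open>b\<close>.\<close>

lemma rational_function_field_power_int_neq:
  assumes "rational_function_field a b"
  shows "a powi n \<noteq> b"
proof
  assume ab: "a powi n = b"
  have indep: "eval2 p a b \<noteq> 0" if "p \<noteq> 0" for p
    using assms that by (auto simp: rational_function_field_def)
  show False
  proof (cases "n \<ge> 0")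
    case True
    have "eval2 [: monom (- 1) (nat n), 1 :] a b = b - a ^ nat n"
      by (simp add: eval2_def map_poly_pCons map_poly_monom poly_monom of_rat_minus)
    then show False using ab True indep[of "[: monom (- 1) (nat n), 1 :]"]
      by (simp add: power_int_def)
  next
    case False
    have "eval2 [: [: - 1 :], monom 1 (nat (- n)) :] a b = b * a ^ nat (- n) - 1"
      by (simp add: eval2_def map_poly_pCons map_poly_monom poly_monom)
    moreover have "a \<noteq> 0"
      \<comment> \<open>This polynomial is the inner variable alone, so its value is
        \<open>a\<close>.\<close>
      using indep[of "[: [: 0, 1 :] :]"] by (auto simp: eval2_def map_poly_pCons)
    ultimately show False using ab False indep[of "[: [: - 1 :], monom 1 (nat (- n)) :]"]
      by (simp add: power_int_def field_simps)
  qed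
qed

section \<open>Separation of the two closures\<close>

theorem proposition5p8:
  fixes \<theta>\<^sub>1 \<theta>\<^sub>2 :: "'k::field_char_0"
    and \<phi> :: "'k \<Rightarrow> 'k"
    and x\<^sub>1 x\<^sub>2 :: nat
    and F :: "('k, (nat \<times> bool) list set, (nat \<times> bool) list set \<times> nat \<Rightarrow> 'k) rep"
  assumes "rational_function_field \<theta>\<^sub>1 \<theta>\<^sub>2"
    and "\<phi> \<in> ring_iso ring_of_type_algebra ring_of_type_algebra"
    and "\<phi> \<theta>\<^sub>1 = \<theta>\<^sub>2" and "\<phi> \<theta>\<^sub>2 = \<theta>\<^sub>1"
    and "F = free_rep {x\<^sub>1} {x\<^sub>2}"
    and "T = generated_congruence F
           {Inr (act F (group_gen {x\<^sub>1} x\<^sub>1) (vec_gen {x\<^sub>1} x\<^sub>2), \<theta>\<^sub>1 \<odot>\<^bsub>vecs F\<^esub> vec_gen {x\<^sub>1} x\<^sub>2)}"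
    and "H = quotient_rep F T"
  shows "\<not> geometrically_equivalent H (twist \<phi> H)"
proof
  assume geo: "geometrically_equivalent H (twist \<phi> H)"
  let ?e = "vec_gen {x\<^sub>1} x\<^sub>2 :: _ \<Rightarrow> 'k" and ?x = "group_gen {x\<^sub>1} x\<^sub>1"
  \<comment> \<open>The zero vector is written as a scalar multiple of the generator, so that
    linearity and the specialization rule for scalars apply to it directly.\<close>
  let ?p = "Inr (act F ?x ?e, \<theta>\<^sub>1 \<odot>\<^bsub>vecs F\<^esub> ?e)" and ?q = "Inr (?e, 0 \<odot>\<^bsub>vecs F\<^esub> ?e)"
  have neq: "\<theta>\<^sub>1 powi n \<noteq> \<theta>\<^sub>2" for n
    using assms(1) by (rule rational_function_field_power_int_neq)
  have \<theta>: "\<theta>\<^sub>1 \<noteq> 0"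
  proof
    assume "\<theta>\<^sub>1 = 0"
    then have "eval2 [: [: 0, 1 :] :] \<theta>\<^sub>1 \<theta>\<^sub>2 = 0" by (simp add: eval2_def map_poly_pCons)
    then show False using assms(1) unfolding rational_function_field_def by fastforce
  qed
  have F: "representation F" unfolding assms(5) by (rule representation_free_rep)
  interpret V: module ring_of_type_algebra "vecs F" using F by (simp add: representation_def)
  have x: "?x \<in> carrier (grp F)" and e: "?e \<in> carrier (vecs F)"
    unfolding assms(5) by (simp_all only: gens_in_free_rep insertI1)
  have sm: "c \<odot>\<^bsub>vecs F\<^esub> v \<in> carrier (vecs F)" if "v \<in> carrier (vecs F)" for c v
    using that V.smult_closed[of c v] by simp
  have ac: "act F g v \<in> carrier (vecs F)" if "g \<in> carrier (grp F)" "v \<in> carrier (vecs F)" for g v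
    using that act_free_rep_carrier[of g "{x\<^sub>1}" "{x\<^sub>2}" v] by (simp add: assms(5))
  have T: "congruence F T"
    unfolding assms(6) using ac[OF x e] sm[OF e]
    by (intro congruence_generated_congruence F) (auto simp: sort_pairs_def)
  have T_iff: "Inr (v, w) \<in> T \<longleftrightarrow> specialize \<theta>\<^sub>1 v = specialize \<theta>\<^sub>1 w"
    if "v \<in> carrier (vecs F)" "w \<in> carrier (vecs F)" for v w
    using that unfolding assms(5,6) by (rule generated_congruence_iff_specialize[OF \<theta>])
  have eqv: "equiv (carrier (vecs F)) (Inr -` T)" using T by (simp add: congruence_def)
  have cls: "(Inr -` T) `` {v} = (Inr -` T) `` {w} \<longleftrightarrow> specialize \<theta>\<^sub>1 v = specialize \<theta>\<^sub>1 w"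
    if "v \<in> carrier (vecs F)" "w \<in> carrier (vecs F)" for v w
    using eq_equiv_class_iff[OF eqv that] T_iff[OF that] by simp
  have spec: "specialize \<theta>\<^sub>1 (c \<odot>\<^bsub>vecs F\<^esub> v) = c * specialize \<theta>\<^sub>1 v" if "v \<in> carrier (vecs F)" for c v
    using that unfolding assms(5) by (rule specialize_smult)
  have "?q \<notin> closure_in F H {?p}"
  proof -
    \<comment> \<open>The natural projection onto \<open>H\<close> respects \<open>?p\<close> and
      separates \<open>?q\<close>: the two sides of \<open>?q\<close> specialize to 1 and 0.\<close>
    let ?\<pi> = "(\<lambda>g. (Inl -` T) `` {g}, \<lambda>v. (Inr -` T) `` {v})"
    have "?p \<in> T" by (auto simp: assms(6) generated_congruence_def)
    then have "(Inr -` T) `` {act F ?x ?e} = (Inr -` T) `` {\<theta>\<^sub>1 \<odot>\<^bsub>vecs F\<^esub> ?e}"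
      by (intro equiv_class_eq[OF eqv]) simp
    then have "{?p} \<subseteq> rep_kernel F ?\<pi>"
      using ac[OF x e] sm[OF e] by (auto simp: rep_kernel_def)
    moreover have "?\<pi> \<in> rep_hom F H"
      unfolding assms(7) by (rule quotient_map_rep_hom[OF F T])
    moreover have "?q \<notin> rep_kernel F ?\<pi>"
      using cls[OF e sm[OF e], of 0] spec[OF e, of 0] by (auto simp: rep_kernel_def)
    ultimately show ?thesis unfolding closure_in_def by blast
  qed
  moreover have "?q \<in> closure_in F (twist \<phi> H) {?p}"
    unfolding closure_in_def
  proof (clarify, goal_cases)
    case (1 _ \<alpha> \<beta>)
    then have hom: "\<alpha> \<in> hom (grp F) (grp H)" "\<beta> \<in> linear_maps (vecs F) (vecs (twist \<phi> H))"
      "\<beta> (act F ?x ?e) = act H (\<alpha> ?x) (\<beta> ?e)"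
      using x e by (auto simp: rep_hom_def twist_def)
    \<comment> \<open>Linearity into the twisted module brings in \<phi>: the scalar
      \<open>c\<close> of \<open>F\<close> acts on the image as \<open>\<phi> c\<close> does in
      \<open>H\<close>.\<close>
    have lin: "\<beta> ?e \<in> carrier (vecs H)" "\<beta> (c \<odot>\<^bsub>vecs F\<^esub> ?e) = \<phi> c \<odot>\<^bsub>vecs H\<^esub> \<beta> ?e" for c
      using hom(2) e by (auto simp: linear_maps_def hom_def twist_def)
    \<comment> \<open>The images of both generators are lifted to \<open>F\<close>, where equality
      of classes becomes equality of specializations.\<close>
    obtain v where v: "v \<in> carrier (vecs F)" "\<beta> ?e = (Inr -` T) `` {v}"
      using lin(1) by (auto simp: assms(7) quotient_rep_def elim!: quotientE)
    have "\<alpha> ?x \<in> carrier (grp H)" using hom(1) x by (auto simp: hom_def)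
    then obtain g where g: "g \<in> carrier (grp F)" "\<alpha> ?x = (Inl -` T) `` {g}"
      by (auto simp: assms(7) quotient_rep_def elim!: quotientE)
    have smult: "\<beta> (c \<odot>\<^bsub>vecs F\<^esub> ?e) = (Inr -` T) `` {\<phi> c \<odot>\<^bsub>vecs F\<^esub> v}" for c
      using quotient_rep_ops(3)[OF T v(1)] by (simp add: lin(2) v(2) assms(7))
    have "\<beta> (act F ?x ?e) = (Inr -` T) `` {act F g v}"
      using quotient_rep_ops(4)[OF T g(1) v(1)] by (simp add: hom(3) v(2) g(2) assms(7))
    moreover have "\<beta> (act F ?x ?e) = \<beta> (\<theta>\<^sub>1 \<odot>\<^bsub>vecs F\<^esub> ?e)"
      using 1 by (auto simp: rep_kernel_def)
    ultimately have "(Inr -` T) `` {act F g v} = (Inr -` T) `` {\<theta>\<^sub>2 \<odot>\<^bsub>vecs F\<^esub> v}"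
      using smult[of \<theta>\<^sub>1] assms(3) by simp
    then have "specialize \<theta>\<^sub>1 (act F g v) = \<theta>\<^sub>2 * specialize \<theta>\<^sub>1 v"
      using cls[OF ac[OF g(1) v(1)] sm[OF v(1)]] spec[OF v(1)] by simp
    moreover have "specialize \<theta>\<^sub>1 (act F g v) = weight \<theta>\<^sub>1 g * specialize \<theta>\<^sub>1 v"
      using specialize_act[OF \<theta>, of g "{x\<^sub>1}" v "{x\<^sub>2}"] g(1) v(1) by (simp add: assms(5))
    \<comment> \<open>By definition \<open>weight\<close> is an integer power of
      \<open>\<theta>\<^sub>1\<close>. The two preceding equations therefore force the
      specialization of \<open>v\<close> to vanish.\<close>
    moreover have "weight \<theta>\<^sub>1 g \<noteq> \<theta>\<^sub>2" using neq by (simp add: weight_def)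
    ultimately have "specialize \<theta>\<^sub>1 v = 0" by simp
    \<comment> \<open>The right side is the class of \<open>\<phi> 0\<close> times \<open>v\<close>,
      whose specialization is \<open>\<phi> 0\<close> times 0; hence both classes agree.\<close>
    then have "\<beta> ?e = \<beta> (0 \<odot>\<^bsub>vecs F\<^esub> ?e)"
      using cls[OF v(1) sm[OF v(1)], of "\<phi> 0"] spec[OF v(1), of "\<phi> 0"] by (simp add: smult v(2))
    then show ?case using e sm[OF e] by (auto simp: rep_kernel_def)
  qed
  moreover have "{?p} \<subseteq> sort_pairs F" using ac[OF x e] sm[OF e] by (auto simp: sort_pairs_def)
  then have "closure_in F H {?p} = closure_in F (twist \<phi> H) {?p}"
    using geo unfolding geometrically_equivalent_def assms(5) by simp
  ultimately show False by simp
qed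

end
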